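(* Let $\vec U$ be a finite distributive universe of separations and let $\vec S\subseteq\vec U$ be a subsystem which is submodular in $\vec U$ and satisfies $|S|\ge3$, where $S=\{\{s,s^*\}\mid s\in\vec S\}$ is its set of unoriented separations. Then there are corner-closed subsystems $\vec S_1,\vec S_2,\vec S_3\subsetneq\vec S$ of $\vec S$ in $\vec U$ which are submodular in $\vec U$ and such that $\vec S_1\cup\vec S_2\cup\vec S_3=\vec S$. Moreover, $\vec S_1,\vec S_2,\vec S_3$ can be chosen disjointly unless $\vec S$ can be corner-faithfully embedded into a universe of bipartitions.
   Context: A separation system is a poset with an order-reversing involution ${}^*$. A universe of separations is a separation system $\vec U$ whose poset is a lattice; it is distributive if the lattice is distributive. A subsystem of a separation system is a subset closed under the involution, with restricted order and involution. A subsystem $\vec S$ of $\vec U$ is submodular in $\vec U$ if for all $r,s\in\vec S$ at least one of $r\vee s$, $r\wedge s$ (taken in $\vec U$) lies in $\vec S$. For a subsystem $\vec S\subseteq\vec U$, a subsystem $\vec S'\subseteq\vec S$ is a corner-closed subsystem of $\vec S$ (in $\vec U$) if for all $r,s\in\vec S'$ we have $r\vee s\in\vec S'$ whenever $r\vee s\in\vec S$. For a set $V$, the bipartition universe $\mathcal B(V)$ (a universe of bipartitions) is the lattice of all subsets of $V$ ordered by inclusion with involution $A^*=V\setminus A$. A corner-faithful embedding of a subsystem $\vec T$ of a universe $\vec U$ into a universe $\vec U'$ is an isomorphism of separation systems (a bijection which, together with its inverse, preserves $\le$, and which commutes with ${}^*$) $\iota\colon\vec T\to\vec T'$ onto a subsystem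 $\vec T'\subseteq\vec U'$ such that for all $r,s\in\vec T$: $\iota(r)\vee\iota(s)=\iota(r\vee s)$ whenever $r\vee s\in\vec T$, and $\iota(r)\wedge\iota(s)=\iota(r\wedge s)$ whenever $r\wedge s\in\vec T$, where joins and meets are taken in $\vec U$ and $\vec U'$ respectively. *)

theory Defs
  imports Main
begin

text \<open>
  Orders and lattices are those of the ambient type; a structure is given by a carrier set and
  a map \<open>star\<close>, of which only the values on the carrier matter.  A universe of separations is a
  carrier closed under the binary \<open>sup\<close> and \<open>inf\<close> of a lattice type, so that these are
  the joins and meets of the universe.  Every universe arises in this way, with the carrier a
  whole type, and the bipartition universe of a set \<open>V\<close> is the carrier \<open>Pow V\<close>.
\<close>

definition separation_system :: "'a::order set \<Rightarrow> ('a \<Rightarrow> 'a) \<Rightarrow> bool" where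
  "separation_system S star \<longleftrightarrow>
     (\<forall>s\<in>S. star s \<in> S \<and> star (star s) = s) \<and>
     (\<forall>r\<in>S. \<forall>s\<in>S. r \<le> s \<longrightarrow> star s \<le> star r)"

definition sep_universe :: "'a::lattice set \<Rightarrow> ('a \<Rightarrow> 'a) \<Rightarrow> bool" where
  "sep_universe U star \<longleftrightarrow>
     separation_system U star \<and> (\<forall>r\<in>U. \<forall>s\<in>U. sup r s \<in> U \<and> inf r s \<in> U)"

definition distributive :: "'a::lattice set \<Rightarrow> bool" where
  "distributive U \<longleftrightarrow>
     (\<forall>r\<in>U. \<forall>s\<in>U. \<forall>t\<in>U.
        inf r (sup s t) = sup (inf r s) (inf r t) \<and> sup r (inf s t) = inf (sup r s) (sup r t))"

definition subsystem :: "'a::order set \<Rightarrow> 'a set \<Rightarrow> ('a \<Rightarrow> 'a) \<Rightarrow> bool" where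
  "subsystem S' S star \<longleftrightarrow> S' \<subseteq> S \<and> (\<forall>s\<in>S'. star s \<in> S')"

text \<open>
  Submodularity and corner-closedness refer to the joins and meets in the surrounding universe, i.e.
  to those of the type; the universe is therefore not an argument.
\<close>

definition submodular :: "'a::lattice set \<Rightarrow> bool" where
  "submodular S \<longleftrightarrow> (\<forall>r\<in>S. \<forall>s\<in>S. sup r s \<in> S \<or> inf r s \<in> S)"

definition corner_closed_subsystem :: "'a::lattice set \<Rightarrow> 'a set \<Rightarrow> ('a \<Rightarrow> 'a) \<Rightarrow> bool" where
  "corner_closed_subsystem S' S star \<longleftrightarrow>
     subsystem S' S star \<and> (\<forall>r\<in>S'. \<forall>s\<in>S'. sup r s \<in> S \<longrightarrow> sup r s \<in> S')"

definition unoriented :: "'a set \<Rightarrow> ('a \<Rightarrow> 'a) \<Rightarrow> 'a set set" where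
  "unoriented S star = {{s, star s} | s. s \<in> S}"

definition separation_iso ::
  "('a::order \<Rightarrow> 'b::order) \<Rightarrow> 'a set \<Rightarrow> ('a \<Rightarrow> 'a) \<Rightarrow> 'b set \<Rightarrow> ('b \<Rightarrow> 'b) \<Rightarrow> bool" where
  "separation_iso \<iota> T star T' star' \<longleftrightarrow>
     bij_betw \<iota> T T' \<and>
     (\<forall>r\<in>T. \<forall>s\<in>T. \<iota> r \<le> \<iota> s \<longleftrightarrow> r \<le> s) \<and>
     (\<forall>s\<in>T. \<iota> (star s) = star' (\<iota> s))"

definition corner_faithful_embedding ::
  "('a::lattice \<Rightarrow> 'b::lattice) \<Rightarrow> 'a set \<Rightarrow> ('a \<Rightarrow> 'a) \<Rightarrow> 'b set \<Rightarrow> ('b \<Rightarrow> 'b) \<Rightarrow> bool" where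
  "corner_faithful_embedding \<iota> T star U' star' \<longleftrightarrow>
     (\<exists>T'. subsystem T' U' star' \<and> separation_iso \<iota> T star T' star') \<and>
     (\<forall>r\<in>T. \<forall>s\<in>T.
        (sup r s \<in> T \<longrightarrow> sup (\<iota> r) (\<iota> s) = \<iota> (sup r s)) \<and>
        (inf r s \<in> T \<longrightarrow> inf (\<iota> r) (\<iota> s) = \<iota> (inf r s)))"

lemma sep_universe_bipartitions: "sep_universe (Pow V) (\<lambda>A. V - A)"
  by (auto simp: sep_universe_def separation_system_def)

text \<open>
  HOL cannot quantify existentially over the type of the ground set \<open>V\<close>.  For finite \<open>T\<close>,
  ground sets of natural numbers suffice: see \<open>bipartition_embeddable_if_any_type\<close> below.
\<close>

definition bipartition_embeddable :: "'a::lattice set \<Rightarrow> ('a \<Rightarrow> 'a) \<Rightarrow> bool" where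
  "bipartition_embeddable T star \<longleftrightarrow>
     (\<exists>(V :: nat set) \<iota>. corner_faithful_embedding \<iota> T star (Pow V) (\<lambda>A. V - A))"

lemma bipartition_embeddable_if_any_type:
  fixes T :: "'a::lattice set" and V :: "'v set"
  assumes fin: "finite T"
    and emb: "corner_faithful_embedding \<iota> T star (Pow V) (\<lambda>A. V - A)"
    and closed: "\<And>s. s \<in> T \<Longrightarrow> star s \<in> T"
  shows "bipartition_embeddable T star"
proof -
  define p where "p v = {t \<in> T. v \<in> \<iota> t}" for v
  have "finite (p ` V)"
    by (rule finite_subset[of _ "Pow T"]) (auto simp: p_def fin)
  then obtain f :: "'a set \<Rightarrow> nat" where f: "inj_on f (p ` V)"
    using finite_imp_inj_to_nat_seg[of "p ` V"] by auto
  define g where "g v = f (p v)" for v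
  define \<kappa> where "\<kappa> t = g ` \<iota> t" for t
  from emb obtain T' where T': "T' \<subseteq> Pow V" and bij: "bij_betw \<iota> T T'"
    and ord: "\<And>r s. r \<in> T \<Longrightarrow> s \<in> T \<Longrightarrow> \<iota> r \<subseteq> \<iota> s \<longleftrightarrow> r \<le> s"
    and st: "\<And>s. s \<in> T \<Longrightarrow> \<iota> (star s) = V - \<iota> s"
    and joins: "\<And>r s. r \<in> T \<Longrightarrow> s \<in> T \<Longrightarrow> sup r s \<in> T \<Longrightarrow> \<iota> (sup r s) = \<iota> r \<union> \<iota> s"
    and meets: "\<And>r s. r \<in> T \<Longrightarrow> s \<in> T \<Longrightarrow> inf r s \<in> T \<Longrightarrow> \<iota> (inf r s) = \<iota> r \<inter> \<iota> s"
    unfolding corner_faithful_embedding_def subsystem_def separation_iso_def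
    by (elim conjE exE) simp
  have sub: "\<iota> t \<subseteq> V" if "t \<in> T" for t
    using that bij T' by (auto simp: bij_betw_def)
  have sat: "v \<in> \<iota> t \<longleftrightarrow> g v \<in> \<kappa> t" if t: "t \<in> T" and v: "v \<in> V" for t v
  proof
    assume "g v \<in> \<kappa> t"
    then obtain w where w: "w \<in> \<iota> t" "g v = g w" by (auto simp: \<kappa>_def)
    then have "p v = p w"
      using inj_onD[OF f] v sub[OF t] by (auto simp: g_def)
    then show "v \<in> \<iota> t" using w(1) t by (auto simp: p_def)
  qed (auto simp: \<kappa>_def)
  have \<kappa>: "\<kappa> t \<subseteq> g ` V" if "t \<in> T" for t
    using sub[OF that] by (auto simp: \<kappa>_def)
  have le: "\<kappa> r \<subseteq> \<kappa> s \<longleftrightarrow> r \<le> s" if "r \<in> T" "s \<in> T" for r s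
  proof -
    have "\<kappa> r \<subseteq> \<kappa> s \<longleftrightarrow> \<iota> r \<subseteq> \<iota> s"
    proof
      assume l: "\<kappa> r \<subseteq> \<kappa> s"
      show "\<iota> r \<subseteq> \<iota> s"
      proof
        fix v assume v: "v \<in> \<iota> r"
        then have "v \<in> V" using sub[OF that(1)] by auto
        moreover have "g v \<in> \<kappa> s" using v l by (auto simp: \<kappa>_def)
        ultimately show "v \<in> \<iota> s" using sat[OF that(2)] by simp
      qed
    qed (auto simp: \<kappa>_def)
    then show ?thesis using ord[OF that] by simp
  qed
  have star: "\<kappa> (star s) = g ` V - \<kappa> s" if "s \<in> T" for s
  proof -
    have "g ` (V - \<iota> s) = g ` V - \<kappa> s"
      using sat[OF that] by (auto simp: \<kappa>_def[of s])
    then show ?thesis using st[OF that] by (simp add: \<kappa>_def[of "star s"])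
  qed
  have join: "\<kappa> r \<union> \<kappa> s = \<kappa> (sup r s)" if "r \<in> T" "s \<in> T" "sup r s \<in> T" for r s
    using joins[OF that] by (auto simp: \<kappa>_def)
  have meet: "\<kappa> r \<inter> \<kappa> s = \<kappa> (inf r s)" if "r \<in> T" "s \<in> T" "inf r s \<in> T" for r s
  proof
    show "\<kappa> r \<inter> \<kappa> s \<subseteq> \<kappa> (inf r s)"
    proof
      fix y assume y: "y \<in> \<kappa> r \<inter> \<kappa> s"
      then obtain v where v: "v \<in> \<iota> r" "y = g v" by (auto simp: \<kappa>_def)
      then have "v \<in> V" using sub[OF that(1)] by auto
      then have "v \<in> \<iota> s" using sat[OF that(2)] y v(2) by simp
      then show "y \<in> \<kappa> (inf r s)" using v meets[OF that] by (auto simp: \<kappa>_def)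
    qed
  qed (use meets[OF that] in \<open>auto simp: \<kappa>_def\<close>)
  have "inj_on \<kappa> T"
  proof (rule inj_onI)
    fix r s assume "r \<in> T" "s \<in> T" "\<kappa> r = \<kappa> s"
    then have "r \<le> s" "s \<le> r" using le[of r s] le[of s r] by simp_all
    then show "r = s" by (rule order.antisym)
  qed
  then have "separation_iso \<kappa> T star (\<kappa> ` T) (\<lambda>A. g ` V - A)"
    unfolding separation_iso_def bij_betw_def by (intro conjI ballI) (simp_all only: le star)
  moreover have "subsystem (\<kappa> ` T) (Pow (g ` V)) (\<lambda>A. g ` V - A)"
    unfolding subsystem_def
  proof (intro conjI ballI)
    show "\<kappa> ` T \<subseteq> Pow (g ` V)" using \<kappa> by auto
    fix A assume "A \<in> \<kappa> ` T"
    then obtain s where s: "s \<in> T" "A = \<kappa> s" by auto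
    then have "g ` V - A = \<kappa> (star s)" using star by simp
    then show "g ` V - A \<in> \<kappa> ` T" using closed[OF s(1)] by simp
  qed
  ultimately have "corner_faithful_embedding \<kappa> T star (Pow (g ` V)) (\<lambda>A. g ` V - A)"
    unfolding corner_faithful_embedding_def
    by (intro conjI ballI impI exI[of _ "\<kappa> ` T"]) (simp_all add: join meet)
  then show ?thesis unfolding bipartition_embeddable_def by (intro exI)
qed

end

theory Submission
  imports Defs
begin

text \<open>
  A prime element \<open>j\<close> of the distributive lattice sorts the separations \<open>s\<close> by how many of
  \<open>s\<close>, \<open>s\<^sup>*\<close> lie above it: both, neither, or exactly one.  Each of these three classes
  is closed under the involution and under joins and meets, so for every \<open>j\<close> for which no class is
  all of \<open>S\<close> they form a disjoint decomposition.  If no such \<open>j\<close> exists, let \<open>V\<close> be the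
  set of those \<open>j\<close> that lie below exactly one of \<open>s\<close>, \<open>s\<^sup>*\<close> for every \<open>s\<close>; the other
  primes do not distinguish elements of \<open>S\<close>, and so \<open>s \<mapsto> {j \<in> V. j \<le> s}\<close> embeds
  \<open>S\<close> into the bipartitions of \<open>V\<close>.  As \<open>S\<close> has at least three unoriented separations, some
  three points of \<open>V\<close> are pairwise separated by \<open>S\<close>.  A bipartition cannot separate all
  three pairs, so the subsystems of the separations that do not separate a given pair cover
  \<open>S\<close>.
\<close>

text \<open>The corner that submodularity of \<open>S\<close> provides for two members again
  satisfies \<open>P\<close>. Every subsystem used below is cut out of \<open>S\<close> by such a
  \<open>P\<close>.\<close>

lemma corner_closed_submodular_Collect:
  assumes "submodular S"
    and "\<And>s. s \<in> S \<Longrightarrow> star s \<in> S"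
    and "\<And>s. s \<in> S \<Longrightarrow> P s \<Longrightarrow> P (star s)"
    and "\<And>r s. r \<in> S \<Longrightarrow> s \<in> S \<Longrightarrow> P r \<Longrightarrow> P s \<Longrightarrow> P (sup r s)"
    and "\<And>r s. r \<in> S \<Longrightarrow> s \<in> S \<Longrightarrow> P r \<Longrightarrow> P s \<Longrightarrow> P (inf r s)"
  shows "corner_closed_subsystem {s \<in> S. P s} S star \<and> submodular {s \<in> S. P s}"
  using assms by (simp add: corner_closed_subsystem_def subsystem_def submodular_def)

section \<open>De Morgan laws for the involution\<close>

lemma star_sup:
  assumes "sep_universe U star" "r \<in> U" "s \<in> U"
  shows "star (sup r s) = inf (star r) (star s)"
proof (rule order.antisym)
  note U = assms(1)[unfolded sep_universe_def separation_system_def]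
  show "star (sup r s) \<le> inf (star r) (star s)"
    using U assms(2,3) by simp
  have m: "inf (star r) (star s) \<in> U" using U assms(2,3) by simp
  have "star (star r) \<le> star (inf (star r) (star s))" "star (star s) \<le> star (inf (star r) (star s))"
    using U assms(2,3) m by (meson inf.cobounded1 inf.cobounded2)+
  then have "sup r s \<le> star (inf (star r) (star s))" using U assms(2,3) by simp
  then have "star (star (inf (star r) (star s))) \<le> star (sup r s)"
    using U assms(2,3) m by blast
  then show "inf (star r) (star s) \<le> star (sup r s)" using U m by simp
qed

lemma star_inf:
  assumes "sep_universe U star" "r \<in> U" "s \<in> U"
  shows "star (inf r s) = sup (star r) (star s)"
proof -
  note U = assms(1)[unfolded sep_universe_def separation_system_def]
  have "star (sup (star r) (star s)) = inf r s"
    using star_sup[OF assms(1), of "star r" "star s"] U assms(2,3) by simp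
  then have "star (inf r s) = star (star (sup (star r) (star s)))" by simp
  also have "\<dots> = sup (star r) (star s)" using U assms(2,3) by simp
  finally show ?thesis .
qed

section \<open>Primes of a finite distributive lattice\<close>

text \<open>The least element of \<open>U\<close> is prime in this sense.\<close>

definition join_prime :: "'a::lattice set \<Rightarrow> 'a \<Rightarrow> bool" where
  "join_prime U j \<longleftrightarrow> j \<in> U \<and> (\<forall>a\<in>U. \<forall>b\<in>U. j \<le> sup a b \<longrightarrow> j \<le> a \<or> j \<le> b)"

lemma join_prime_le_sup_iff:
  assumes "join_prime U j" "a \<in> U" "b \<in> U"
  shows "j \<le> sup a b \<longleftrightarrow> j \<le> a \<or> j \<le> b"
  using assms by (auto simp: join_prime_def intro: le_supI1 le_supI2)

text \<open>An element \<open>j\<close> minimal among those below \<open>r\<close> but not below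
  \<open>s\<close> is prime: its meets with elements not above it are strictly smaller, hence below
  \<open>s\<close>, and by distributivity \<open>j\<close> cannot be the join of two such
  meets.\<close>

lemma join_prime_separates:
  assumes "finite U" "distributive U" "\<And>a b. a \<in> U \<Longrightarrow> b \<in> U \<Longrightarrow> inf a b \<in> U"
    and "r \<in> U" "s \<in> U" "\<not> r \<le> s"
  obtains j where "join_prime U j" "j \<le> r" "\<not> j \<le> s"
proof -
  let ?A = "{a \<in> U. a \<le> r \<and> \<not> a \<le> s}"
  have "finite ?A" "?A \<noteq> {}" using assms by auto
  then obtain j where j: "j \<in> ?A" and min: "\<And>a. a \<in> ?A \<Longrightarrow> a \<le> j \<Longrightarrow> j = a"
    using finite_has_minimal[of ?A] by blast
  have below: "inf j a \<le> s" if a: "a \<in> U" "\<not> j \<le> a" for a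
  proof (rule ccontr)
    assume "\<not> inf j a \<le> s"
    then have "inf j a \<in> ?A" using j a assms(3) by (auto intro: le_infI1)
    then have "j = inf j a" using min by simp
    then show False using a(2) by (simp add: inf.order_iff)
  qed
  have "j \<le> a \<or> j \<le> b" if "a \<in> U" "b \<in> U" "j \<le> sup a b" for a b
  proof (rule ccontr)
    assume "\<not> (j \<le> a \<or> j \<le> b)"
    then have "sup (inf j a) (inf j b) \<le> s" using below that by simp
    moreover have "inf j (sup a b) = sup (inf j a) (inf j b)"
      using assms(2) j that unfolding distributive_def by blast
    ultimately show False using j that(3) by (metis (no_types, lifting) inf.orderE mem_Collect_eq)
  qed
  then have "join_prime U j" using j by (simp add: join_prime_def)
  then show ?thesis using j that by simp
qed

locale distributive_submodular_system =
  fixes U S :: "'a::lattice set" and star :: "'a \<Rightarrow> 'a"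
  assumes universe: "sep_universe U star"
    and finite_U: "finite U"
    and distributive_U: "distributive U"
    and subsystem_S: "subsystem S U star"
    and submodular_S: "submodular S"
begin

lemma S_in_U: "s \<in> S \<Longrightarrow> s \<in> U"
  and star_in_S: "s \<in> S \<Longrightarrow> star s \<in> S"
  and star_star: "s \<in> S \<Longrightarrow> star (star s) = s"
  using subsystem_S universe
  by (auto simp: subsystem_def sep_universe_def separation_system_def)

lemma star_sup_S: "r \<in> S \<Longrightarrow> s \<in> S \<Longrightarrow> star (sup r s) = inf (star r) (star s)"
  and star_inf_S: "r \<in> S \<Longrightarrow> s \<in> S \<Longrightarrow> star (inf r s) = sup (star r) (star s)"
  using star_sup[OF universe] star_inf[OF universe] S_in_U by auto

lemma prime_le_sup:
  "join_prime U j \<Longrightarrow> r \<in> S \<Longrightarrow> s \<in> S \<Longrightarrow> j \<le> sup r s \<longleftrightarrow> j \<le> r \<or> j \<le> s"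
  by (simp add: join_prime_le_sup_iff S_in_U)

section \<open>The three classes of separations at a prime\<close>

definition both :: "'a \<Rightarrow> 'a set" where
  "both j = {s \<in> S. j \<le> s \<and> j \<le> star s}"

definition neither :: "'a \<Rightarrow> 'a set" where
  "neither j = {s \<in> S. \<not> j \<le> s \<and> \<not> j \<le> star s}"

definition split :: "'a \<Rightarrow> 'a set" where
  "split j = {s \<in> S. (j \<le> s) \<noteq> (j \<le> star s)}"

text \<open>For a prime \<open>j\<close>, a join takes the disjunction of the values of
  \<open>j \<le> s\<close> and the conjunction of those of \<open>j \<le> star s\<close>; a meet
  does the reverse. Each class is stable under both operations.\<close>

lemma classes_corner_closed_submodular:
  assumes "join_prime U j" "S' \<in> {both j, neither j, split j}"
  shows "corner_closed_subsystem S' S star \<and> submodular S'"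
proof -
  note simps = star_sup_S star_inf_S star_star prime_le_sup[OF assms(1)] star_in_S
  have "corner_closed_subsystem (both j) S star \<and> submodular (both j)"
    unfolding both_def
    by (rule corner_closed_submodular_Collect[OF submodular_S]) (auto simp: simps)
  moreover have "corner_closed_subsystem (neither j) S star \<and> submodular (neither j)"
    unfolding neither_def
    by (rule corner_closed_submodular_Collect[OF submodular_S]) (auto simp: simps)
  moreover have "corner_closed_subsystem (split j) S star \<and> submodular (split j)"
    unfolding split_def
    by (rule corner_closed_submodular_Collect[OF submodular_S]) (auto simp: simps)
  ultimately show ?thesis using assms(2) by blast
qed

lemma classes_partition:
  "both j \<union> neither j \<union> split j = S"
  "both j \<inter> neither j = {}" "both j \<inter> split j = {}" "neither j \<inter> split j = {}"
  by (auto simp: both_def neither_def split_def)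

section \<open>Embedding into bipartitions\<close>

definition points :: "'a set" where
  "points = {j. join_prime U j \<and> split j = S}"

lemma points_prime: "j \<in> points \<Longrightarrow> join_prime U j"
  by (simp add: points_def)

lemma points_le_star: "j \<in> points \<Longrightarrow> s \<in> S \<Longrightarrow> j \<le> star s \<longleftrightarrow> \<not> j \<le> s"
  by (auto simp: points_def split_def)

text \<open>A prime below \<open>r\<close> but not below \<open>s\<close> rules out that
  \<open>both\<close> or \<open>neither\<close> is all of \<open>S\<close>, so by
  \<open>const\<close> it is a point.\<close>

lemma le_iff_points:
  assumes const: "\<And>j. join_prime U j \<Longrightarrow> S \<in> {both j, neither j, split j}"
    and "r \<in> S" "s \<in> S"
  shows "r \<le> s \<longleftrightarrow> (\<forall>j\<in>points. j \<le> r \<longrightarrow> j \<le> s)"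
proof
  assume below: "\<forall>j\<in>points. j \<le> r \<longrightarrow> j \<le> s"
  show "r \<le> s"
  proof (rule ccontr)
    assume "\<not> r \<le> s"
    then obtain j where j: "join_prime U j" "j \<le> r" "\<not> j \<le> s"
      using join_prime_separates[OF finite_U distributive_U] universe S_in_U assms(2,3)
      unfolding sep_universe_def by metis
    have "S \<noteq> both j" "S \<noteq> neither j"
      using j assms(2,3) by (auto simp: both_def neither_def)
    then have "j \<in> points" using const[OF j(1)] j(1) by (auto simp: points_def)
    then show False using below j by simp
  qed
qed (auto intro: order.trans)

lemma embeddable:
  assumes const: "\<And>j. join_prime U j \<Longrightarrow> S \<in> {both j, neither j, split j}"
  shows "bipartition_embeddable S star"
proof -
  define \<iota> where "\<iota> s = {j \<in> points. j \<le> s}" for s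
  have le: "\<iota> r \<subseteq> \<iota> s \<longleftrightarrow> r \<le> s" if "r \<in> S" "s \<in> S" for r s
    using le_iff_points[OF const that] by (auto simp: \<iota>_def)
  have star: "\<iota> (star s) = points - \<iota> s" if "s \<in> S" for s
    using that by (auto simp: \<iota>_def points_le_star)
  have "inj_on \<iota> S"
    by (rule inj_onI) (metis le order.antisym order.refl)
  then have "separation_iso \<iota> S star (\<iota> ` S) (\<lambda>A. points - A)"
    using le star by (simp add: separation_iso_def bij_betw_def)
  moreover have "subsystem (\<iota> ` S) (Pow points) (\<lambda>A. points - A)"
    unfolding subsystem_def
  proof (intro conjI ballI)
    show "\<iota> ` S \<subseteq> Pow points" by (auto simp: \<iota>_def)
    show "points - A \<in> \<iota> ` S" if "A \<in> \<iota> ` S" for A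
      using that star star_in_S by (metis imageE imageI)
  qed
  moreover have "sup (\<iota> r) (\<iota> s) = \<iota> (sup r s)" "inf (\<iota> r) (\<iota> s) = \<iota> (inf r s)"
    if "r \<in> S" "s \<in> S" for r s
    using that by (auto simp: \<iota>_def prime_le_sup[OF points_prime])
  ultimately have "corner_faithful_embedding \<iota> S star (Pow points) (\<lambda>A. points - A)"
    unfolding corner_faithful_embedding_def by blast
  \<comment> \<open>The points are lattice elements; finiteness of \<open>S\<close> allows a ground
    set of natural numbers instead.\<close>
  moreover have "finite S" using finite_U S_in_U by (blast intro: finite_subset)
  ultimately show ?thesis
    using bipartition_embeddable_if_any_type star_in_S by blast
qed

section \<open>Subsystems that do not separate two points\<close>

definition unseparated :: "'a \<Rightarrow> 'a \<Rightarrow> 'a set" where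
  "unseparated j k = {s \<in> S. j \<le> s \<longleftrightarrow> k \<le> s}"

lemma unseparated_corner_closed_submodular:
  assumes "j \<in> points" "k \<in> points"
  shows "corner_closed_subsystem (unseparated j k) S star \<and> submodular (unseparated j k)"
  unfolding unseparated_def
  by (rule corner_closed_submodular_Collect[OF submodular_S])
    (use assms in \<open>auto simp: points_le_star prime_le_sup points_prime star_in_S\<close>)

text \<open>Otherwise the points fall into at most two classes not separated by \<open>S\<close>, so
  two truth values determine a separation. As the involution flips both, at most two unoriented
  separations remain.\<close>

lemma three_separated_points:
  assumes const: "\<And>j. join_prime U j \<Longrightarrow> S \<in> {both j, neither j, split j}"
    and card: "card (unoriented S star) \<ge> 3"
  shows "\<exists>j\<in>points. \<exists>k\<in>points. \<exists>l\<in>points.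
    unseparated j k \<noteq> S \<and> unseparated k l \<noteq> S \<and> unseparated j l \<noteq> S"
proof (rule ccontr)
  assume none: "\<not> ?thesis"
  \<comment> \<open>Two separated points serve as \<open>a\<close> and \<open>b\<close>. If there
    are none, any point serves as both, and without points the claim is vacuous.\<close>
  have "\<exists>a b. \<forall>j\<in>points. unseparated j a = S \<or> unseparated j b = S"
  proof (cases "\<exists>a\<in>points. \<exists>b\<in>points. unseparated a b \<noteq> S")
    case True
    then show ?thesis using none by blast
  qed blast
  then obtain a b where ab: "\<And>j. j \<in> points \<Longrightarrow> unseparated j a = S \<or> unseparated j b = S"
    by blast
  have eqI: "r = s" if "r \<in> S" "s \<in> S" "\<And>j. j \<in> points \<Longrightarrow> j \<le> r \<longleftrightarrow> j \<le> s" for r s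
    using that le_iff_points[OF const, of r s] le_iff_points[OF const, of s r]
    by (auto intro: order.antisym)
  \<comment> \<open>If \<open>s\<close> and \<open>t\<close> agree at \<open>a\<close>, they also
    agree at \<open>b\<close> and hence at every point. If they differ at \<open>a\<close>, they
    differ at \<open>b\<close> too, and the involution, which negates the value at each point, takes
    \<open>s\<close> to \<open>t\<close>.\<close>
  have det: "{s, star s} = {t, star t}"
    if st: "s \<in> S" "t \<in> S" "(a \<le> s \<longleftrightarrow> b \<le> s) = (a \<le> t \<longleftrightarrow> b \<le> t)" for s t
  proof -
    have on: "(\<forall>r\<in>S. j \<le> r \<longleftrightarrow> a \<le> r) \<or> (\<forall>r\<in>S. j \<le> r \<longleftrightarrow> b \<le> r)" if "j \<in> points" for j
      using ab[OF that] by (auto simp: unseparated_def)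
    show ?thesis
    proof (cases "a \<le> s \<longleftrightarrow> a \<le> t")
      case True
      then have "s = t" using st on by (intro eqI) metis+
      then show ?thesis by simp
    next
      case False
      then have "star s = t"
        using st on points_le_star star_in_S by (intro eqI) metis+
      then show ?thesis using star_star[OF st(1)] by auto
    qed
  qed
  \<comment> \<open>\<open>rep c\<close> is arbitrary if no member of \<open>S\<close> has the value
    \<open>c\<close>; this is harmless for an upper bound.\<close>
  define rep where "rep c = (SOME s. s \<in> S \<and> (a \<le> s \<longleftrightarrow> b \<le> s) = c)" for c
  have rep: "rep c \<in> S \<and> (a \<le> rep c \<longleftrightarrow> b \<le> rep c) = c"
    if "s \<in> S" "(a \<le> s \<longleftrightarrow> b \<le> s) = c" for s c
    unfolding rep_def by (rule someI[of _ s]) (simp add: that)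
  have "unoriented S star \<subseteq> (\<lambda>c. {rep c, star (rep c)}) ` UNIV"
  proof
    fix x assume "x \<in> unoriented S star"
    then obtain s where s: "s \<in> S" "x = {s, star s}" by (auto simp: unoriented_def)
    then show "x \<in> (\<lambda>c. {rep c, star (rep c)}) ` UNIV"
      using det[of s "rep (a \<le> s \<longleftrightarrow> b \<le> s)"] rep[OF s(1) refl] by blast
  qed
  then have "card (unoriented S star) \<le> card (UNIV :: bool set)"
    by (rule surj_card_le[OF finite])
  then show False using card by simp
qed

text \<open>Two of the three truth values at \<open>j\<close>, \<open>k\<close> and \<open>l\<close>
  coincide.\<close>

lemma unseparated_cover: "unseparated j k \<union> unseparated k l \<union> unseparated j l = S"
  by (auto simp: unseparated_def)

end

theorem theorem6p3:
  fixes U S :: "'a::lattice set" and star :: "'a \<Rightarrow> 'a"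
  assumes "sep_universe U star"
    and "finite U"
    and "distributive U"
    and "subsystem S U star"
    and "submodular S"
    and "card (unoriented S star) \<ge> 3"
  shows
    "(\<exists>S1 S2 S3.
        (\<forall>S' \<in> {S1, S2, S3}. corner_closed_subsystem S' S star \<and> S' \<subset> S \<and> submodular S') \<and>
        S1 \<union> S2 \<union> S3 = S) \<and>
     (\<not> bipartition_embeddable S star \<longrightarrow>
       (\<exists>S1 S2 S3.
          (\<forall>S' \<in> {S1, S2, S3}. corner_closed_subsystem S' S star \<and> S' \<subset> S \<and> submodular S') \<and>
          S1 \<union> S2 \<union> S3 = S \<and>
          S1 \<inter> S2 = {} \<and> S1 \<inter> S3 = {} \<and> S2 \<inter> S3 = {}))"
proof -
  interpret distributive_submodular_system U S star
    using assms by unfold_locales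
  show ?thesis
  proof (cases "\<exists>j. join_prime U j \<and> S \<notin> {both j, neither j, split j}")
    case True
    then obtain j where j: "join_prime U j" "S \<notin> {both j, neither j, split j}" by blast
    \<comment> \<open>A class may be empty; what matters is that none is all of
      \<open>S\<close>.\<close>
    have "\<forall>S' \<in> {both j, neither j, split j}.
        corner_closed_subsystem S' S star \<and> S' \<subset> S \<and> submodular S'"
      using classes_corner_closed_submodular[OF j(1)] classes_partition(1)[of j] j(2) by blast
    then show ?thesis using classes_partition[of j] by blast
  next
    case False
    then have const: "\<And>j. join_prime U j \<Longrightarrow> S \<in> {both j, neither j, split j}" by blast
    \<comment> \<open>Here \<open>S\<close> embeds, so only a cover is needed and disjointness is
      not asked for.\<close>
    from three_separated_points[OF const assms(6)]
    obtain j k l where jkl: "j \<in> points" "k \<in> points" "l \<in> points"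
      "unseparated j k \<noteq> S" "unseparated k l \<noteq> S" "unseparated j l \<noteq> S"
      by blast
    have "\<forall>S' \<in> {unseparated j k, unseparated k l, unseparated j l}.
        corner_closed_subsystem S' S star \<and> S' \<subset> S \<and> submodular S'"
      using unseparated_corner_closed_submodular jkl by (auto simp: unseparated_def)
    then show ?thesis using unseparated_cover[of j k l] embeddable[OF const] by blast
  qed
qed

end
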